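(* Let $G$ be a cubic graph admitting an $\mathbb{S}^2$-flow, and let $v\in V(G)$. Then the graph obtained from $G$ by blowing up $v$ into a triangle also admits an $\mathbb{S}^2$-flow.
   Context: An $\mathbb{S}^2$-flow is a map from the edges of some orientation of the graph to unit vectors of $\mathbb{R}^3$ such that at every vertex the sum over outgoing edges equals the sum over incoming edges. Blowing up a vertex $v$ (with incident edges $vx_1,vx_2,vx_3$) into a triangle means deleting $v$, adding a triangle on new vertices $t_1,t_2,t_3$, and adding edges $t_ix_i$ for $i=1,2,3$. *)

theory Defs
  imports "HOL-Analysis.Analysis" "Graph_Theory.Digraph"
begin

text \<open>Undirected graphs with edge identities: parallel edges are allowed, loops are not.
  Simple graphs are the case where \<open>ends\<close> is injective on the edges.
  (A cubic graph with a loop at \<open>u\<close> has no \<open>S\<^sup>2\<close>-flow anyway: the two contributions of the loop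
  at \<open>u\<close> cancel, which would force the third edge at \<open>u\<close> to carry the zero vector.)\<close>

record ('v, 'e) multigraph =
  vertices :: "'v set"
  edges :: "'e set"
  ends :: "'e \<Rightarrow> 'v set"

definition wf_multigraph :: "('v, 'e) multigraph \<Rightarrow> bool" where
  "wf_multigraph G \<longleftrightarrow> (\<forall>e\<in>edges G. ends G e \<subseteq> vertices G \<and> card (ends G e) = 2)"

definition incident_edges :: "('v, 'e) multigraph \<Rightarrow> 'v \<Rightarrow> 'e set" where
  "incident_edges G u = {e \<in> edges G. u \<in> ends G e}"

definition cubic :: "('v, 'e) multigraph \<Rightarrow> bool" where
  "cubic G \<longleftrightarrow> wf_multigraph G \<and> (\<forall>u\<in>vertices G. card (incident_edges G u) = 3)"

definition orientation_of :: "('v, 'e) pre_digraph \<Rightarrow> ('v, 'e) multigraph \<Rightarrow> bool" where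
  "orientation_of D G \<longleftrightarrow>
     verts D = vertices G \<and> arcs D = edges G \<and> (\<forall>e\<in>edges G. {tail D e, head D e} = ends G e)"

text \<open>The sums are meaningful only at vertices of finite degree.\<close>

definition S2_flow :: "('v, 'e) pre_digraph \<Rightarrow> ('e \<Rightarrow> real ^ 3) \<Rightarrow> bool" where
  "S2_flow D f \<longleftrightarrow>
     (\<forall>e\<in>arcs D. norm (f e) = 1) \<and>
     (\<forall>u\<in>verts D. (\<Sum>e\<in>out_arcs D u. f e) = (\<Sum>e\<in>in_arcs D u. f e))"

definition admits_S2_flow :: "('v, 'e) multigraph \<Rightarrow> bool" where
  "admits_S2_flow G \<longleftrightarrow> (\<exists>D f. orientation_of D G \<and> S2_flow D f)"

text \<open>Blowing up \<open>v\<close>, whose incident edges join it to \<open>x 1\<close>, \<open>x 2\<close>, \<open>x 3\<close>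
  (with repetitions if there are parallel edges). The new vertex \<open>t\<^sub>i\<close> is \<open>Inr i\<close>; \<open>Link i\<close> is the
  edge \<open>t\<^sub>i x\<^sub>i\<close>, and \<open>Side i\<close> is the triangle edge opposite \<open>t\<^sub>i\<close>.\<close>

datatype 'e blown_edge = Old 'e | Link 3 | Side 3

definition blow_up ::
  "('v, 'e) multigraph \<Rightarrow> 'v \<Rightarrow> (3 \<Rightarrow> 'v) \<Rightarrow> ('v + 3, 'e blown_edge) multigraph" where
  "blow_up G v x =
     \<lparr> vertices = Inl ` (vertices G - {v}) \<union> range Inr,
       edges = Old ` (edges G - incident_edges G v) \<union> range Link \<union> range Side,
       ends = (\<lambda>d. case d of
                 Old e \<Rightarrow> Inl ` ends G e
               | Link i \<Rightarrow> {Inr i, Inl (x i)}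
               | Side i \<Rightarrow> Inr ` (UNIV - {i})) \<rparr>"

lemma cubic_blow_up:
  fixes G :: "('v, 'e) multigraph" and e :: "3 \<Rightarrow> 'e"
  assumes G: "cubic G" and v: "v \<in> vertices G"
    and e: "bij_betw e UNIV (incident_edges G v)"
    and x: "\<And>i. ends G (e i) = {v, x i}"
  shows "cubic (blow_up G v x)"
proof -
  let ?H = "blow_up G v x"
  have wf: "\<And>d. d \<in> edges G \<Longrightarrow> ends G d \<subseteq> vertices G \<and> card (ends G d) = 2"
    and deg: "\<And>u. u \<in> vertices G \<Longrightarrow> card (incident_edges G u) = 3"
    using G by (auto simp: cubic_def wf_multigraph_def)
  have eE: "e i \<in> edges G" for i
    using e by (auto simp: bij_betw_def incident_edges_def)
  have xV: "x i \<in> vertices G" "x i \<noteq> v" for i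
    using wf[OF eE[of i]] x[of i] by (auto simp: card_insert_if split: if_splits)
  have c2: "card (UNIV - {i}) = 2" for i :: 3
    by (simp add: card_Diff_subset)
  have wfH: "wf_multigraph ?H"
    using wf xV
    by (auto simp: wf_multigraph_def blow_up_def incident_edges_def card_image c2 subset_iff image_iff)
      (metis Diff_iff singletonD)
  have degH: "card (incident_edges ?H w) = 3" if w: "w \<in> vertices ?H" for w
  proof (cases w)
    case (Inr i)
    have "incident_edges ?H w = insert (Link i) (Side ` (UNIV - {i}))"
      by (auto simp: incident_edges_def blow_up_def Inr image_iff)
    moreover have "card (Side ` (UNIV - {i})) = 2"
      by (subst card_image) (auto simp: inj_on_def c2)
    ultimately show ?thesis by (simp add: card_insert_if image_iff)
  next
    case (Inl u)
    then have u: "u \<in> vertices G" "u \<noteq> v" using w by (auto simp: blow_up_def)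
    let ?h = "\<lambda>d. if d \<in> incident_edges G v then Link (inv e d) else Old d"
    have inve: "inv e (e i) = i" for i
      using e by (simp add: bij_betw_def inv_f_f)
    have rng: "incident_edges G v = range e" using e by (simp add: bij_betw_def)
    have "incident_edges ?H w = ?h ` incident_edges G u"
    proof (intro subset_antisym subsetI)
      fix d assume d: "d \<in> incident_edges ?H w"
      show "d \<in> ?h ` incident_edges G u"
      proof (cases d)
        case (Old a) then show ?thesis using d Inl
          by (auto simp: incident_edges_def blow_up_def)
      next
        case (Link i)
        then have "x i = u" using d Inl by (auto simp: incident_edges_def blow_up_def)
        then have "e i \<in> incident_edges G u" "d = ?h (e i)"
          using x[of i] eE Link by (auto simp: incident_edges_def inve)
        then show ?thesis by blast
      next
        case (Side i) then show ?thesis using d Inl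
          by (auto simp: incident_edges_def blow_up_def)
      qed
    next
      fix d assume "d \<in> ?h ` incident_edges G u"
      then obtain a where a: "a \<in> incident_edges G u" "d = ?h a" by blast
      show "d \<in> incident_edges ?H w"
      proof (cases "a \<in> incident_edges G v")
        case True
        then obtain i where "a = e i" using rng by blast
        then show ?thesis using a True x[of i] u Inl
          by (auto simp: incident_edges_def blow_up_def inve)
      next
        case False then show ?thesis using a u Inl
          by (auto simp: incident_edges_def blow_up_def)
      qed
    qed
    moreover have "inj_on ?h (incident_edges G u)"
      unfolding inj_on_def rng by (auto simp: inve)
    ultimately show ?thesis using deg[OF u(1)] by (metis card_image)
  qed
  show ?thesis using wfH degH by (simp add: cubic_def)
qed

end

theory Submission imports Defs begin

text \<open>The flow values leaving \<open>v\<close> are three unit vectors \<open>a\<^sub>1, a\<^sub>2, a\<^sub>3\<close> with sum zero. On the triangle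
  we need unit vectors whose cyclic differences are the \<open>a\<^sub>i\<close>. The vectors
  \<open>(a\<^sub>3 - a\<^sub>2) / 3, (a\<^sub>1 - a\<^sub>3) / 3, (a\<^sub>2 - a\<^sub>1) / 3\<close> have the right differences and common length
  \<open>1 / \<surd>3\<close>, and they lie in the plane of the \<open>a\<^sub>i\<close>; adding the same normal vector of length
  \<open>\<surd>(2/3)\<close> to each of them makes them unit vectors.\<close>

text \<open>In type \<open>3\<close> the numeral 3 equals 0, so \<open>i\<close>,
  \<open>i + 1\<close>, \<open>i + 2\<close> run through all indices. This treats the triangle's
  corners uniformly, without a case split.\<close>

lemma three_cyclic:
  fixes i :: 3
  shows "i + 1 + 1 = i + 2" "i + 1 + 2 = i" "i + 2 + 1 = i" "i + 2 + 2 = i + 1"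
    "i + 1 \<noteq> i" "i + 2 \<noteq> i" "i + 1 \<noteq> i + 2"
    "UNIV = {i, i + 1, i + 2}"
proof -
  have three: "(3::3) = 0" by simp
  have "(1::3) + 2 = 3" "(2::3) + 2 = 3 + 1" by simp_all
  then show "i + 1 + 1 = i + 2" "i + 1 + 2 = i" "i + 2 + 1 = i" "i + 2 + 2 = i + 1"
    unfolding three by (simp_all add: add.assoc)
  have one: "(1::3) \<noteq> 2" by simp
  then show "i + 1 \<noteq> i" "i + 2 \<noteq> i" "i + 1 \<noteq> i + 2" by simp_all
  then have "card {i, i + 1, i + 2} = CARD(3)" by auto
  then show "UNIV = {i, i + 1, i + 2}"
    by (metis card_subset_eq finite subset_UNIV)
qed

lemma unit_vectors_with_cyclic_differences:
  fixes a :: "3 \<Rightarrow> real ^ 3"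
  assumes unit: "\<And>i. norm (a i) = 1" and sum: "(\<Sum>i\<in>UNIV. a i) = 0"
  obtains c where "\<And>i. norm (c i) = 1" "\<And>i. c (i + 2) + a i = c (i + 1)"
proof -
  have sum_i: "a i + a (i + 1) + a (i + 2) = 0" for i
  proof -
    have "(\<Sum>j\<in>{i, i + 1, i + 2}. a j) = 0"
      using sum by (simp only: three_cyclic(8)[of i])
    then show ?thesis
      using three_cyclic(5-7)[of i] by (simp add: add.assoc)
  qed
  have sq: "a i \<bullet> a i = 1" for i
    using unit[of i] by (simp add: dot_square_norm)
  \<comment> \<open>Squaring \<open>a i = - (a (i + 1) + a (i + 2))\<close> gives 1 = 2 + 2p for the
    inner product p: the vectors meet at 120 degrees.\<close>
  have inner: "a (i + 1) \<bullet> a (i + 2) = -1/2" for i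
  proof -
    have "a i = - (a (i + 1) + a (i + 2))"
      using sum_i[of i] by (simp only: add.assoc eq_neg_iff_add_eq_0)
    then have "a i \<bullet> a i = (a (i + 1) + a (i + 2)) \<bullet> (a (i + 1) + a (i + 2))"
      by (metis inner_minus_left inner_minus_right minus_minus)
    then show ?thesis
      by (simp add: inner_add inner_commute sq)
  qed
  define n where "n = cross3 (a 1) (a 2)"
  have n12: "n \<bullet> a 1 = 0" "n \<bullet> a 2 = 0"
    by (simp_all add: n_def dot_cross_self inner_commute)
  moreover have "a 3 = - (a 1 + a 2)"
    using sum by (simp only: sum_3 eq_neg_iff_add_eq_0 add.commute[of _ "a 3"])
  ultimately have n: "n \<bullet> a i = 0" for i
    using exhaust_3[of i] by (auto simp: inner_diff)
  have a12: "a 1 \<bullet> a 2 = -1/2"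
    using inner[of 0] by simp
  \<comment> \<open>Lagrange's identity: 1 * 1 - (-1/2)^2 = 3/4.\<close>
  have nn: "n \<bullet> n = 3/4"
    using a12 by (simp add: n_def dot_cross sq inner_commute[of "a 2" "a 1"])
  \<comment> \<open>The squared factor is 8/9, and 8/9 * 3/4 = 2/3.\<close>
  define w where "w = (2 * sqrt 2 / 3) *\<^sub>R n"
  have ww: "w \<bullet> w = 2/3" and w: "w \<bullet> a i = 0" "a i \<bullet> w = 0" for i
    by (simp_all add: w_def nn n inner_commute[of "a i"])
  define c where "c i = (1/3) *\<^sub>R (a (i + 2) - a (i + 1)) + w" for i
  show thesis
  proof
    fix i
    \<comment> \<open>The planar part contributes (1 + 1 + 1) / 9 = 1/3, the normal part
      2/3.\<close>
    have "c i \<bullet> c i = 1"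
      by (simp add: c_def inner_add inner_diff w ww sq inner
          inner_commute[of "a (i + 2)" "a (i + 1)"])
    then show "norm (c i) = 1" by (simp add: norm_eq_1)
    \<comment> \<open>In the difference \<open>w\<close> cancels, leaving
      \<open>(2 * a i - a (i + 1) - a (i + 2)) / 3\<close>, which is \<open>a i\<close> by the zero
      sum. Coordinates make this linear real arithmetic.\<close>
    have "(c (i + 2) + a i) $ k = c (i + 1) $ k" for k
      using arg_cong[OF sum_i[of i], of "\<lambda>y. y $ k"]
      unfolding c_def three_cyclic(1-4) by (simp add: diff_divide_distrib; linarith)
    then show "c (i + 2) + a i = c (i + 1)"
      unfolding vec_eq_iff by blast
  qed
qed

text \<open>Without loops, out-arcs and in-arcs partition the incident edges, so the signed sum is
  outflow minus inflow. Its index set does not depend on the orientation, which eases reindexing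
  between graphs.\<close>

lemma flow_balance_iff_signed_sum:
  assumes "orientation_of D G" "wf_multigraph G" "finite (incident_edges G u)"
  shows "(\<Sum>d\<in>out_arcs D u. f d) = (\<Sum>d\<in>in_arcs D u. f d) \<longleftrightarrow>
    (\<Sum>d\<in>incident_edges G u. if tail D d = u then f d else - f d :: 'a :: ab_group_add) = 0"
proof -
  have ends: "{tail D d, head D d} = ends G d" "tail D d \<noteq> head D d" if d: "d \<in> edges G" for d
  proof -
    show D_ends: "{tail D d, head D d} = ends G d"
      using assms(1) d by (simp add: orientation_of_def)
    have "card (ends G d) = 2"
      using assms(2) d by (simp add: wf_multigraph_def)
    then show "tail D d \<noteq> head D d"
      by (auto simp flip: D_ends)
  qed
  have inc: "incident_edges G u = out_arcs D u \<union> in_arcs D u"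
    using assms(1) by (auto simp: incident_edges_def orientation_of_def simp flip: ends(1))
  have disj: "out_arcs D u \<inter> in_arcs D u = {}"
    using assms(1) ends(2) by (auto simp: orientation_of_def)
  have neg: "(\<Sum>d\<in>in_arcs D u. if tail D d = u then f d else - f d) = - (\<Sum>d\<in>in_arcs D u. f d)"
    unfolding sum_negf[symmetric] using disj by (intro sum.cong) (auto simp: disjoint_iff)
  have "(\<Sum>d\<in>incident_edges G u. if tail D d = u then f d else - f d) =
      (\<Sum>d\<in>out_arcs D u. f d) - (\<Sum>d\<in>in_arcs D u. f d)"
    using assms(3) unfolding inc by (subst sum.union_disjoint) (simp_all add: disj neg)
  then show ?thesis by simp
qed

theorem theorem4p11:
  fixes G :: "('v, 'e) multigraph" and v :: 'v and e :: "3 \<Rightarrow> 'e" and x :: "3 \<Rightarrow> 'v"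
  assumes "cubic G"
    and "admits_S2_flow G"
    and "v \<in> vertices G"
    and "bij_betw e UNIV (incident_edges G v)"
    and "\<And>i. ends G (e i) = {v, x i}"
  shows "admits_S2_flow (blow_up G v x)"
proof -
  let ?H = "blow_up G v x"
  note x = assms(5)
  obtain D f where D: "orientation_of D G" and f: "S2_flow D f"
    using assms(2) by (auto simp: admits_S2_flow_def)
  have cubH: "cubic ?H" by (rule cubic_blow_up[OF assms(1,3,4) x])
  have wf: "wf_multigraph G" "wf_multigraph ?H"
    using assms(1) cubH by (auto simp: cubic_def)
  have fin: "u \<in> vertices G \<Longrightarrow> finite (incident_edges G u)"
    "w \<in> vertices ?H \<Longrightarrow> finite (incident_edges ?H w)" for u w
    using assms(1) cubH by (simp_all add: cubic_def card_ge_0_finite)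
  have inj: "inj e" and rng: "incident_edges G v = range e"
    using assms(4) by (auto simp: bij_betw_def)
  have eE: "e i \<in> edges G" for i
    using rng by (auto simp: incident_edges_def)
  have xv: "x i \<noteq> v" for i
    using wf(1) eE[of i] x[of i] by (auto simp: wf_multigraph_def)
  have D_ends: "{tail D d, head D d} = ends G d" if "d \<in> edges G" for d
    using D that by (simp add: orientation_of_def)
  have norm_f: "norm (f d) = 1" if "d \<in> edges G" for d
    using f D that by (simp add: S2_flow_def orientation_of_def)
  have balance: "(\<Sum>d\<in>incident_edges G u. if tail D d = u then f d else - f d) = 0"
    if "u \<in> vertices G" for u
    using f that fin(1)[OF that] D wf(1)
    by (simp add: flow_balance_iff_signed_sum[symmetric] S2_flow_def orientation_of_def)
  \<comment> \<open>The sign makes \<open>a i\<close> the flow out of \<open>v\<close> along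
    \<open>e i\<close>, whatever the orientation of \<open>e i\<close> in \<open>D\<close>.\<close>
  define a where "a i = (if tail D (e i) = v then f (e i) else - f (e i))" for i
  have "(\<Sum>i\<in>UNIV. a i) = 0"
    using balance[OF assms(3)] by (simp add: rng sum.reindex[OF inj] a_def)
  moreover have norm_a: "norm (a i) = 1" for i
    using norm_f[OF eE] by (simp add: a_def)
  ultimately obtain c
    where norm_c: "\<And>i. norm (c i) = 1" and c: "\<And>i. c (i + 2) + a i = c (i + 1)"
    using unit_vectors_with_cyclic_differences by blast
  \<comment> \<open>Links point away from the triangle, and the sides form a directed cycle: at
    corner \<open>i\<close>, \<open>Side (i + 1)\<close> enters and \<open>Side (i + 2)\<close>
    leaves. Balance there is exactly the equation \<open>c\<close>.\<close>
  define D' where "D' = \<lparr> verts = vertices ?H, arcs = edges ?H,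
      tail = (\<lambda>d. case d of Old d \<Rightarrow> Inl (tail D d) | Link i \<Rightarrow> Inr i | Side i \<Rightarrow> Inr (i + 1)),
      head = (\<lambda>d. case d of Old d \<Rightarrow> Inl (head D d) | Link i \<Rightarrow> Inl (x i) | Side i \<Rightarrow> Inr (i + 2)) \<rparr>"
  define g where "g d = (case d of Old d \<Rightarrow> f d | Link i \<Rightarrow> a i | Side i \<Rightarrow> c i)" for d
  have compl: "UNIV - {i} = {i + 1, i + 2}" for i :: 3
    using three_cyclic(5-7)[of i] by (subst three_cyclic(8)[of i]) auto
  have D': "orientation_of D' ?H"
    by (auto simp: orientation_of_def D'_def blow_up_def compl simp flip: D_ends)
  have norm_g: "\<forall>d\<in>arcs D'. norm (g d) = 1"
    using norm_f norm_a norm_c by (auto simp: D'_def g_def blow_up_def)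
  have signed: "(\<Sum>d\<in>incident_edges ?H w. if tail D' d = w then g d else - g d) = 0"
    if w: "w \<in> vertices ?H" for w
  proof (cases w)
    case (Inr i)
    have "incident_edges ?H w = {Link i, Side (i + 1), Side (i + 2)}"
      using three_cyclic(5-8)[of i] by (auto simp: incident_edges_def blow_up_def Inr image_iff)
    then show ?thesis
      using c[of i] three_cyclic(5-7)[of i]
      by (simp add: Inr D'_def g_def three_cyclic(1-4) algebra_simps)
  next
    case (Inl u)
    then have u: "u \<in> vertices G" "u \<noteq> v" using w by (auto simp: blow_up_def)
    \<comment> \<open>The edges at \<open>u\<close> are matched with those at \<open>w\<close> by
      edge identity, since parallel edges may give several links at the same neighbour.\<close>
    define h where "h d = (if d \<in> range e then Link (inv e d) else Old d)" for d
    have he: "h (e i) = Link i" for i using inj by (simp add: h_def)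
    have hO: "h d = Old d" if "d \<notin> range e" for d using that by (simp add: h_def)
    have "incident_edges ?H w = h ` incident_edges G u"
    proof (intro subset_antisym subsetI)
      fix d assume d: "d \<in> incident_edges ?H w"
      show "d \<in> h ` incident_edges G u"
      proof (cases d)
        case (Old b)
        then have b: "b \<in> incident_edges G u" "b \<notin> incident_edges G v"
          using d Inl by (auto simp: incident_edges_def blow_up_def)
        then have "d = h b" by (simp add: Old hO rng)
        with b(1) show ?thesis by blast
      next
        case (Link i)
        then have "e i \<in> incident_edges G u" "d = h (e i)"
          using d Inl eE x by (auto simp: incident_edges_def blow_up_def he)
        then show ?thesis by blast
      next
        case (Side i) then show ?thesis using d Inl
          by (auto simp: incident_edges_def blow_up_def)
      qed
    next
      fix d assume "d \<in> h ` incident_edges G u"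
      then obtain b where b: "b \<in> incident_edges G u" "d = h b" by blast
      show "d \<in> incident_edges ?H w"
      proof (cases "b \<in> range e")
        case True
        then obtain i where "b = e i" by blast
        then show ?thesis using b x[of i] u Inl
          by (auto simp: incident_edges_def blow_up_def he)
      next
        case False
        then have "b \<notin> incident_edges G v" by (simp add: rng)
        then show ?thesis using b Inl hO[OF False]
          by (auto simp: incident_edges_def blow_up_def)
      qed
    qed
    moreover have "inj_on h (incident_edges G u)"
      by (auto simp: inj_on_def h_def inv_f_f[OF inj])
    moreover have "(if tail D' (h d) = w then g (h d) else - g (h d)) =
        (if tail D d = u then f d else - f d)" if d: "d \<in> incident_edges G u" for d
    proof (cases "d \<in> range e")
      case True
      then obtain i where i: "d = e i" by blast
      \<comment> \<open>Here \<open>x i = u\<close>. \<open>Link i\<close> enters \<open>w\<close>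
        and contributes \<open>- a i\<close>; as exactly one of \<open>u\<close>, \<open>v\<close>
        is the tail of \<open>e i\<close>, this equals the signed contribution of \<open>e i\<close>
        at \<open>u\<close>.\<close>
      have "tail D (e i) = v \<longleftrightarrow> tail D (e i) \<noteq> u"
        using d D_ends[OF eE[of i]] x[of i] u i xv[of i]
        by (auto simp: incident_edges_def doubleton_eq_iff)
      then show ?thesis by (simp add: i he D'_def Inl g_def a_def)
    next
      case False then show ?thesis by (simp add: hO D'_def Inl g_def)
    qed
    ultimately show ?thesis
      using balance[OF u(1)] by (simp add: sum.reindex cong: sum.cong)
  qed
  have "S2_flow D' g"
    using norm_g signed flow_balance_iff_signed_sum[OF D' wf(2) fin(2)]
    by (auto simp: S2_flow_def D'_def)
  then show ?thesis using D' by (auto simp: admits_S2_flow_def)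
qed

end
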